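(* Let $(G,\oplus)$ be a Smarandache Moufang loop. (1) If every $f,g$-principal isotope of $(G,\oplus)$ is a Smarandache $f,g$-principal isotope of $(G,\oplus)$, then $(G,\oplus)$ is universal, i.e. every loop isotopic to $(G,\oplus)$ is a Smarandache Moufang loop. (2) Conversely, if $(G,\oplus)$ is a universal Smarandache Moufang loop, then there is a non-trivial Moufang subloop $(S,\oplus)$ of $(G,\oplus)$ such that for all $f,g\in S$ the following six triples are autotopisms of $(S,\oplus)$: $$(R_{g}L_f^{-1}L_{g^\lambda}R_g^{-1},\;L_fR_g^{-1}R_{f^\rho}L_f^{-1},\;L_f^{-1}L_{g^\lambda}R_g^{-1}R_{f^\rho}),$$ $$(R_{g}L_f^{-1}L_{g^\lambda}R_g^{-1},\;L_fR_g^{-1}R_{f^\rho}L_f^{-1},\;R_g^{-1}R_{f^\rho}L_f^{-1}L_{g^\lambda}),$$ $$(R_gL_f^{-1}L_{g^\lambda}R_g^{-1}R_{f^\rho}R_g^{-1},\;L_fL_{g^\lambda}^{-1},\;L_f^{-1}L_{g^\lambda}),$$ $$(R_gR_{f^\rho}^{-1},\;L_fR_g^{-1}R_{f^\rho}L_f^{-1}L_{g^\lambda}L_f^{-1},\;R_g^{-1}R_{f^\rho}),$$ $$(R_gL_f^{-1}L_{g^\lambda}R_g^{-1},\;L_{g^\lambda}R_g^{-1}R_{f^\rho}L_{g^\lambda}^{-1},\;R_g^{-1}R_{f^\rho}L_f^{-1}L_{g^\lambda}),$$ $$(R_{f^\rho}L_f^{-1}L_{g^\lambda}R_{f^\rh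o}^{-1},\;L_fR_g^{-1}R_{f^\rho}L_f^{-1},\;L_f^{-1}L_{g^\lambda}R_g^{-1}R_{f^\rho}).$$
   Context: A Moufang loop is a loop satisfying $(xy)(zx)=[x(yz)]x$ (equivalently any of the other Moufang identities). A Smarandache Moufang loop is a loop with at least one non-trivial (more than one element) subloop that is a Moufang loop. It is universal if every loop isotopic to it is again a Smarandache Moufang loop. An S-subloop of a loop is a non-trivial subloop which is a group under the loop operation. Loops $(G,\oplus)$ and $(H,\otimes)$ are isotopic if there are bijections $A,B,C:G\to H$ with $xA\otimes yB=(x\oplus y)C$ for all $x,y\in G$. Maps are written on the right of their arguments and composed from left to right. $xR_g=x\oplus g$, $yL_f=f\oplus y$. With $e$ the identity element, $f^\rho$ and $g^\lambda$ are defined by $f\oplus f^\rho=e$ and $g^\lambda\oplus g=e$. An autotopism of $(S,\oplus)$ is a triple $(A,B,C)$ of bijections of $S$ with $xA\oplus yB=(x\oplus y)C$ for all $x,y\in S$; in such triples the translations are those of $(S,\oplus)$. For $f,g\in G$ the $f,g$-principal isotope of $(G,\oplus)$ is the loop $(G,\circ)$ with $xR_g\circ yL_f=x\oplus y$ for all $x,y\in G$. An $f,g$-principal isotope of $(G,\oplus)$ is any $(G,\circ)$ arising in this way from some $f,g\in G$. $(G,\circ)$ is a Smarandache $f,g$-principal isotope of $(G,\oplus)$ if there are an S-subloop $(S,\oplus)$ of $(G,\oplus)$ and elements $f,g\in S$ such that $xR_g\circ yL_f=x\oplus y$ for all $x,y\in G$; then $f,g$ are called S-elements. *)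

theory Defs
  imports "HOL-Algebra.Group"
begin

text \<open>
  Loops are carried by the HOL-Algebra record type \<open>monoid\<close>, which merely provides a carrier, a
  multiplication and a unit and does not impose associativity.  A subset \<open>S\<close> of the carrier is
  viewed as a structure of its own via \<open>G\<lparr>carrier := S\<rparr>\<close>.
\<close>

locale loop =
  fixes G (structure)
  assumes m_closed: "\<lbrakk>x \<in> carrier G; y \<in> carrier G\<rbrakk> \<Longrightarrow> x \<otimes> y \<in> carrier G"
    and one_closed: "\<one> \<in> carrier G"
    and l_one: "x \<in> carrier G \<Longrightarrow> \<one> \<otimes> x = x"
    and r_one: "x \<in> carrier G \<Longrightarrow> x \<otimes> \<one> = x"
    and ex1_right_factor: "\<lbrakk>a \<in> carrier G; b \<in> carrier G\<rbrakk> \<Longrightarrow> \<exists>!y. y \<in> carrier G \<and> a \<otimes> y = b"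
    and ex1_left_factor: "\<lbrakk>a \<in> carrier G; b \<in> carrier G\<rbrakk> \<Longrightarrow> \<exists>!x. x \<in> carrier G \<and> x \<otimes> a = b"

locale moufang_loop = loop +
  assumes moufang: "\<lbrakk>x \<in> carrier G; y \<in> carrier G; z \<in> carrier G\<rbrakk>
    \<Longrightarrow> (x \<otimes> y) \<otimes> (z \<otimes> x) = (x \<otimes> (y \<otimes> z)) \<otimes> x"

text \<open>
  Requiring the unit of \<open>G\<close> to be the unit of the subloop is no restriction: a unit of \<open>S\<close> is
  idempotent, and the only idempotent of a loop is its unit.
\<close>

definition subloop :: "'a set \<Rightarrow> ('a, 'm) monoid_scheme \<Rightarrow> bool" where
  "subloop S G \<longleftrightarrow> S \<subseteq> carrier G \<and> loop (G\<lparr>carrier := S\<rparr>)"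

definition nontrivial :: "'a set \<Rightarrow> bool" where
  "nontrivial S \<longleftrightarrow> (\<exists>x\<in>S. \<exists>y\<in>S. x \<noteq> y)"

definition S_subloop :: "'a set \<Rightarrow> ('a, 'm) monoid_scheme \<Rightarrow> bool" where
  "S_subloop S G \<longleftrightarrow> subloop S G \<and> nontrivial S \<and> group (G\<lparr>carrier := S\<rparr>)"

definition nontrivial_moufang_subloop :: "'a set \<Rightarrow> ('a, 'm) monoid_scheme \<Rightarrow> bool" where
  "nontrivial_moufang_subloop S G \<longleftrightarrow>
     subloop S G \<and> nontrivial S \<and> moufang_loop (G\<lparr>carrier := S\<rparr>)"

definition smarandache_moufang_loop :: "('a, 'm) monoid_scheme \<Rightarrow> bool" where
  "smarandache_moufang_loop G \<longleftrightarrow> loop G \<and> (\<exists>S. nontrivial_moufang_subloop S G)"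

definition isotopism ::
  "('a, 'm) monoid_scheme \<Rightarrow> ('b, 'n) monoid_scheme \<Rightarrow> ('a \<Rightarrow> 'b) \<Rightarrow> ('a \<Rightarrow> 'b) \<Rightarrow> ('a \<Rightarrow> 'b) \<Rightarrow> bool"
  where
  "isotopism G H A B C \<longleftrightarrow>
     bij_betw A (carrier G) (carrier H) \<and>
     bij_betw B (carrier G) (carrier H) \<and>
     bij_betw C (carrier G) (carrier H) \<and>
     (\<forall>x\<in>carrier G. \<forall>y\<in>carrier G. A x \<otimes>\<^bsub>H\<^esub> B y = C (x \<otimes>\<^bsub>G\<^esub> y))"

definition isotopic :: "('a, 'm) monoid_scheme \<Rightarrow> ('b, 'n) monoid_scheme \<Rightarrow> bool" where
  "isotopic G H \<longleftrightarrow> (\<exists>A B C. isotopism G H A B C)"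

definition autotopism ::
  "('a, 'm) monoid_scheme \<Rightarrow> ('a \<Rightarrow> 'a) \<Rightarrow> ('a \<Rightarrow> 'a) \<Rightarrow> ('a \<Rightarrow> 'a) \<Rightarrow> bool" where
  "autotopism G A B C \<longleftrightarrow> isotopism G G A B C"

text \<open>
  HOL has no quantification over types inside a formula, so universality is relative to the type
  \<open>'b\<close> of the elements of the isotopic loops.  For \<open>G\<close> over \<open>'a\<close>, the instance at \<open>'a\<close> already
  yields all others: a loop over any type that is isotopic to \<open>G\<close> has a carrier in bijection with
  that of \<open>G\<close> and so has an isomorphic copy on \<open>carrier G\<close>.
\<close>

definition universal_smarandache_moufang_loop ::
  "'b itself \<Rightarrow> ('a, 'm) monoid_scheme \<Rightarrow> bool" where
  "universal_smarandache_moufang_loop (T :: 'b itself) G \<longleftrightarrow>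
     smarandache_moufang_loop G \<and>
     (\<forall>H :: 'b monoid. loop H \<and> isotopic G H \<longrightarrow> smarandache_moufang_loop H)"

definition right_translation :: "('a, 'm) monoid_scheme \<Rightarrow> 'a \<Rightarrow> 'a \<Rightarrow> 'a" where
  "right_translation G g = (\<lambda>x. x \<otimes>\<^bsub>G\<^esub> g)"

definition left_translation :: "('a, 'm) monoid_scheme \<Rightarrow> 'a \<Rightarrow> 'a \<Rightarrow> 'a" where
  "left_translation G f = (\<lambda>y. f \<otimes>\<^bsub>G\<^esub> y)"

definition right_translation_inv :: "('a, 'm) monoid_scheme \<Rightarrow> 'a \<Rightarrow> 'a \<Rightarrow> 'a" where
  "right_translation_inv G g = inv_into (carrier G) (right_translation G g)"

definition left_translation_inv :: "('a, 'm) monoid_scheme \<Rightarrow> 'a \<Rightarrow> 'a \<Rightarrow> 'a" where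
  "left_translation_inv G f = inv_into (carrier G) (left_translation G f)"

definition right_inverse :: "('a, 'm) monoid_scheme \<Rightarrow> 'a \<Rightarrow> 'a" where
  "right_inverse G f = (THE y. y \<in> carrier G \<and> f \<otimes>\<^bsub>G\<^esub> y = \<one>\<^bsub>G\<^esub>)"

definition left_inverse :: "('a, 'm) monoid_scheme \<Rightarrow> 'a \<Rightarrow> 'a" where
  "left_inverse G g = (THE x. x \<in> carrier G \<and> x \<otimes>\<^bsub>G\<^esub> g = \<one>\<^bsub>G\<^esub>)"

text \<open>
  \<open>H\<close> is the \<open>f,g\<close>-principal isotope of \<open>G\<close>.  This is a relation because the multiplication of the
  record \<open>H\<close> is unconstrained outside the carrier.
\<close>

definition principal_isotope ::
  "('a, 'm) monoid_scheme \<Rightarrow> 'a \<Rightarrow> 'a \<Rightarrow> ('a, 'n) monoid_scheme \<Rightarrow> bool" where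
  "principal_isotope G f g H \<longleftrightarrow>
     f \<in> carrier G \<and> g \<in> carrier G \<and> loop H \<and> carrier H = carrier G \<and>
     (\<forall>x\<in>carrier G. \<forall>y\<in>carrier G.
        right_translation G g x \<otimes>\<^bsub>H\<^esub> left_translation G f y = x \<otimes>\<^bsub>G\<^esub> y)"

definition smarandache_principal_isotope ::
  "('a, 'm) monoid_scheme \<Rightarrow> ('a, 'n) monoid_scheme \<Rightarrow> bool" where
  "smarandache_principal_isotope G H \<longleftrightarrow>
     (\<exists>S. S_subloop S G \<and> (\<exists>f\<in>S. \<exists>g\<in>S. principal_isotope G f g H))"

text \<open>
  Maps act on the right of their arguments and are composed from left to right; \<open>fcomp\<close> is this
  composition: \<open>(A \<circ>> B) x = B (A x)\<close>.
\<close>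

notation fcomp (infixl "\<circ>>" 60)

end

theory Submission
  imports Defs
begin

text \<open>
  (1) A loop isotopic to \<open>G\<close> is isomorphic to an \<open>f,g\<close>-principal isotope of \<open>G\<close>, by choosing
  \<open>f\<close> and \<open>g\<close> as the elements that the first two components send to the unit.  If \<open>f\<close> and \<open>g\<close> lie
  in a group \<open>S\<close>, the isotope multiplies \<open>S\<close> by \<open>x g\<^sup>-\<^sup>1 f\<^sup>-\<^sup>1 y\<close>, again a group operation.

  (2) The six triples are autotopisms for every Moufang subloop.  The left and right Bol
  identities provide the autotopisms \<open>\<beta>\<^sub>a = (L\<^sub>a R\<^sub>a, L\<^sub>a\<^sup>-\<^sup>1, L\<^sub>a)\<close> and \<open>\<rho>\<^sub>a = (R\<^sub>a\<^sup>-\<^sup>1, L\<^sub>a R\<^sub>a, R\<^sub>a)\<close>.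
  With \<open>a = f\<^sup>-\<^sup>1\<close> and \<open>b = g\<^sup>-\<^sup>1\<close>, the triples are \<open>\<beta>\<^sub>a \<beta>\<^sub>b \<rho>\<^sub>b \<rho>\<^sub>a\<close>, \<open>\<rho>\<^sub>b \<rho>\<^sub>a \<beta>\<^sub>a \<beta>\<^sub>b\<close>, \<open>\<beta>\<^sub>a \<beta>\<^sub>b\<close>, \<open>\<rho>\<^sub>b \<rho>\<^sub>a\<close>,
  \<open>\<rho>\<^sub>b \<rho>\<^sub>a \<beta>\<^sub>a \<beta>\<^sub>b\<close>, \<open>\<beta>\<^sub>a \<beta>\<^sub>b \<rho>\<^sub>b \<rho>\<^sub>a\<close>, rewritten with the fact that \<open>L\<^sub>a L\<^sub>b\<close> and \<open>R\<^sub>b R\<^sub>a\<close> commute,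
  which is flexibility of the \<open>f,g\<close>-principal isotope.
\<close>

section \<open>Cancellation and one-sided inverses in loops\<close>

context loop
begin

lemma left_cancel:
  "\<lbrakk>a \<otimes> x = a \<otimes> y; a \<in> carrier G; x \<in> carrier G; y \<in> carrier G\<rbrakk> \<Longrightarrow> x = y"
  using ex1_right_factor[of a "a \<otimes> y"] m_closed by blast

lemma right_cancel:
  "\<lbrakk>x \<otimes> a = y \<otimes> a; a \<in> carrier G; x \<in> carrier G; y \<in> carrier G\<rbrakk> \<Longrightarrow> x = y"
  using ex1_left_factor[of a "y \<otimes> a"] m_closed by blast

lemma right_inverse:
  assumes "x \<in> carrier G"
  shows "right_inverse G x \<in> carrier G" "x \<otimes> right_inverse G x = \<one>"
  using theI'[OF ex1_right_factor[OF assms one_closed]] unfolding right_inverse_def by auto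

lemma left_inverse_eqI:
  assumes "x \<in> carrier G" "y \<in> carrier G" "x \<otimes> y = \<one>"
  shows "left_inverse G y = x"
  unfolding left_inverse_def
  using ex1_left_factor[of y \<one>] assms one_closed by (intro the_equality) auto

end

section \<open>Transport of loop structure along bijections\<close>

lemma loop_iso:
  assumes "loop G" and h: "bij_betw h (carrier G) (carrier H)"
    and hom: "\<And>x y. \<lbrakk>x \<in> carrier G; y \<in> carrier G\<rbrakk> \<Longrightarrow> h (x \<otimes>\<^bsub>G\<^esub> y) = h x \<otimes>\<^bsub>H\<^esub> h y"
    and one: "h \<one>\<^bsub>G\<^esub> = \<one>\<^bsub>H\<^esub>"
  shows "loop H"
proof -
  interpret G: loop G by fact
  have inj: "inj_on h (carrier G)" and im: "carrier H = h ` carrier G"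
    using h by (auto simp: bij_betw_def)
  show ?thesis
  proof
    fix a b assume "a \<in> carrier H" "b \<in> carrier H"
    then obtain x y where xy: "x \<in> carrier G" "a = h x" "y \<in> carrier G" "b = h y"
      unfolding im by blast
    show "a \<otimes>\<^bsub>H\<^esub> b \<in> carrier H"
      using xy by (metis G.m_closed hom im imageI)
    obtain z where z: "z \<in> carrier G" "x \<otimes>\<^bsub>G\<^esub> z = y"
      using G.ex1_right_factor xy by blast
    show "\<exists>!y. y \<in> carrier H \<and> a \<otimes>\<^bsub>H\<^esub> y = b"
    proof (rule ex1I[of _ "h z"])
      show "h z \<in> carrier H \<and> a \<otimes>\<^bsub>H\<^esub> h z = b" using xy z hom[of x z] im by auto
      fix u assume "u \<in> carrier H \<and> a \<otimes>\<^bsub>H\<^esub> u = b"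
      then obtain w where w: "w \<in> carrier G" "u = h w" "a \<otimes>\<^bsub>H\<^esub> h w = b" unfolding im by blast
      then have "h (x \<otimes>\<^bsub>G\<^esub> w) = h (x \<otimes>\<^bsub>G\<^esub> z)" using xy z hom by metis
      then have "x \<otimes>\<^bsub>G\<^esub> w = x \<otimes>\<^bsub>G\<^esub> z" using inj_onD[OF inj] xy z w G.m_closed by blast
      then show "u = h z" using G.left_cancel xy z w by blast
    qed
    obtain z where z: "z \<in> carrier G" "z \<otimes>\<^bsub>G\<^esub> x = y"
      using G.ex1_left_factor xy by blast
    show "\<exists>!x. x \<in> carrier H \<and> x \<otimes>\<^bsub>H\<^esub> a = b"
    proof (rule ex1I[of _ "h z"])
      show "h z \<in> carrier H \<and> h z \<otimes>\<^bsub>H\<^esub> a = b" using xy z hom[of z x] im by auto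
      fix u assume "u \<in> carrier H \<and> u \<otimes>\<^bsub>H\<^esub> a = b"
      then obtain w where w: "w \<in> carrier G" "u = h w" "h w \<otimes>\<^bsub>H\<^esub> a = b" unfolding im by blast
      then have "h (w \<otimes>\<^bsub>G\<^esub> x) = h (z \<otimes>\<^bsub>G\<^esub> x)" using xy z hom by metis
      then have "w \<otimes>\<^bsub>G\<^esub> x = z \<otimes>\<^bsub>G\<^esub> x" using inj_onD[OF inj] xy z w G.m_closed by blast
      then show "u = h z" using G.right_cancel xy z w by blast
    qed
  next
    \<comment> \<open>\<open>H\<close> is not yet known to be a loop, so its unit field is tied to
      the image of the unit of \<open>G\<close> by \<open>one\<close> alone.\<close>
    show "\<one>\<^bsub>H\<^esub> \<in> carrier H" using G.one_closed im one by (metis imageI)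
  next
    fix a assume "a \<in> carrier H"
    then obtain x where x: "x \<in> carrier G" "a = h x" unfolding im by blast
    show "\<one>\<^bsub>H\<^esub> \<otimes>\<^bsub>H\<^esub> a = a" using x by (metis G.l_one G.one_closed hom one)
    show "a \<otimes>\<^bsub>H\<^esub> \<one>\<^bsub>H\<^esub> = a" using x by (metis G.r_one G.one_closed hom one)
  qed
qed

lemma moufang_loop_iso:
  assumes "moufang_loop G" and h: "bij_betw h (carrier G) (carrier H)"
    and hom: "\<And>x y. \<lbrakk>x \<in> carrier G; y \<in> carrier G\<rbrakk> \<Longrightarrow> h (x \<otimes>\<^bsub>G\<^esub> y) = h x \<otimes>\<^bsub>H\<^esub> h y"
    and one: "h \<one>\<^bsub>G\<^esub> = \<one>\<^bsub>H\<^esub>"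
  shows "moufang_loop H"
proof -
  interpret G: moufang_loop G by fact
  interpret H: loop H by (rule loop_iso[OF G.loop_axioms h hom one])
  have im: "carrier H = h ` carrier G" using h by (auto simp: bij_betw_def)
  show ?thesis
  proof
    fix a b c assume "a \<in> carrier H" "b \<in> carrier H" "c \<in> carrier H"
    then obtain x y z where
      xyz: "x \<in> carrier G" "a = h x" "y \<in> carrier G" "b = h y" "z \<in> carrier G" "c = h z"
      unfolding im by blast
    then show "(a \<otimes>\<^bsub>H\<^esub> b) \<otimes>\<^bsub>H\<^esub> (c \<otimes>\<^bsub>H\<^esub> a) = (a \<otimes>\<^bsub>H\<^esub> (b \<otimes>\<^bsub>H\<^esub> c)) \<otimes>\<^bsub>H\<^esub> a"
      using G.moufang[of x y z] by (simp add: hom[symmetric] G.m_closed)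
  qed
qed

lemma (in group) moufang_loop: "moufang_loop G"
proof
  fix a b assume ab: "a \<in> carrier G" "b \<in> carrier G"
  show "\<exists>!y. y \<in> carrier G \<and> a \<otimes> y = b"
    using ab by (intro ex1I[of _ "inv a \<otimes> b"]) (auto simp: m_assoc[symmetric])
  show "\<exists>!x. x \<in> carrier G \<and> x \<otimes> a = b"
    using ab by (intro ex1I[of _ "b \<otimes> inv a"]) (auto simp: m_assoc)
qed (auto simp: m_assoc)

section \<open>Principal isotopes, isotopic loops and their subgroups\<close>

lemma isotopic_imp_iso_principal_isotope:
  fixes G :: "('a, 'm) monoid_scheme" and H :: "('b, 'n) monoid_scheme"
  assumes "loop G" and "loop H" and "isotopic G H"
  obtains f g h and K :: "'a monoid" where "principal_isotope G f g K"
    and "bij_betw h (carrier K) (carrier H)"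
    and "\<And>x y. \<lbrakk>x \<in> carrier K; y \<in> carrier K\<rbrakk> \<Longrightarrow> h (x \<otimes>\<^bsub>K\<^esub> y) = h x \<otimes>\<^bsub>H\<^esub> h y"
    and "h \<one>\<^bsub>K\<^esub> = \<one>\<^bsub>H\<^esub>"
proof -
  interpret H: loop H by fact
  obtain A B C where A: "bij_betw A (carrier G) (carrier H)"
    and B: "bij_betw B (carrier G) (carrier H)" and C: "bij_betw C (carrier G) (carrier H)"
    and ABC: "\<And>x y. \<lbrakk>x \<in> carrier G; y \<in> carrier G\<rbrakk> \<Longrightarrow> A x \<otimes>\<^bsub>H\<^esub> B y = C (x \<otimes>\<^bsub>G\<^esub> y)"
    using \<open>isotopic G H\<close> unfolding isotopic_def isotopism_def by blast
  define D where "D = inv_into (carrier G) C"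
  have D: "bij_betw D (carrier H) (carrier G)" unfolding D_def by (rule bij_betw_inv_into[OF C])
  have CD: "C (D u) = u" if "u \<in> carrier H" for u
    using that C unfolding D_def by (rule bij_betw_inv_into_right[rotated])
  have DC: "D (C x) = x" if "x \<in> carrier G" for x
    using that C unfolding D_def by (simp add: bij_betw_inv_into_left)
  have Cc: "C x \<in> carrier H" if "x \<in> carrier G" for x using C that by (rule bij_betw_apply)
  \<comment> \<open>The operation of \<open>H\<close> is pulled back along \<open>C\<close>. This
    makes \<open>C\<close> an isomorphism from \<open>K\<close> to \<open>H\<close> and turns the
    third component of the isotopism from \<open>G\<close> to \<open>K\<close> into the
    identity.\<close>
  define K where "K = \<lparr>carrier = carrier G, mult = \<lambda>x y. D (C x \<otimes>\<^bsub>H\<^esub> C y), one = D \<one>\<^bsub>H\<^esub>\<rparr>"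
  have carrier: "carrier K = carrier G" and mult: "x \<otimes>\<^bsub>K\<^esub> y = D (C x \<otimes>\<^bsub>H\<^esub> C y)"
    and one: "\<one>\<^bsub>K\<^esub> = D \<one>\<^bsub>H\<^esub>" for x y by (simp_all add: K_def)
  have "loop K"
    by (rule loop_iso[OF \<open>loop H\<close>, where h = D]) (use D in \<open>simp_all add: carrier mult one CD\<close>)
  obtain f where f: "f \<in> carrier G" "A f = \<one>\<^bsub>H\<^esub>"
    using A H.one_closed unfolding bij_betw_def by (metis imageE)
  obtain g where g: "g \<in> carrier G" "B g = \<one>\<^bsub>H\<^esub>"
    using B H.one_closed unfolding bij_betw_def by (metis imageE)
  \<comment> \<open>With \<open>g\<close> or \<open>f\<close> as one argument, one factor in
    \<open>H\<close> becomes the unit. So, seen in \<open>K\<close>, the first two components are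
    the translations by \<open>g\<close> and \<open>f\<close>.\<close>
  have "C (x \<otimes>\<^bsub>G\<^esub> g) = A x" "C (f \<otimes>\<^bsub>G\<^esub> x) = B x" if "x \<in> carrier G" for x
    using ABC[OF that g(1)] ABC[OF f(1) that] f g that bij_betw_apply[OF A that]
      bij_betw_apply[OF B that] by (simp_all add: H.l_one H.r_one)
  moreover have "x \<otimes>\<^bsub>G\<^esub> y \<in> carrier G" if "x \<in> carrier G" "y \<in> carrier G" for x y
    using \<open>loop G\<close> that by (rule loop.m_closed)
  ultimately have "principal_isotope G f g K"
    unfolding principal_isotope_def right_translation_def left_translation_def
    using f g \<open>loop K\<close> by (simp add: carrier mult ABC DC)
  then show ?thesis
    by (rule that[of f g K C])
      (use C in \<open>simp_all add: carrier mult one CD Cc H.m_closed H.one_closed\<close>)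
qed

text \<open>Associativity is available only inside \<open>S\<close>, so the operation of
  \<open>H\<close> on \<open>S\<close> is first rewritten as \<open>x c y\<close> with a fixed
  \<open>c\<close> in \<open>S\<close>. Such an operation is associative, has unit c^-1, and x has
  the inverse c^-1 x^-1 c^-1.\<close>

lemma group_principal_isotope:
  assumes S: "subloop S G" "group (G\<lparr>carrier := S\<rparr>)" and fg: "f \<in> S" "g \<in> S"
    and H: "principal_isotope G f g H"
  shows "group (H\<lparr>carrier := S\<rparr>)"
proof -
  let ?M = "G\<lparr>carrier := S\<rparr>"
  interpret M: group ?M by fact
  interpret H: loop H using H by (simp add: principal_isotope_def)
  note M_simps = M.m_closed[simplified] M.inv_closed[simplified] M.m_assoc[simplified]
    M.l_inv[simplified] M.r_one[simplified]
  have SG: "S \<subseteq> carrier G" using S by (simp add: subloop_def)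
  then have SH: "x \<in> carrier H" if "x \<in> S" for x
    using H that by (auto simp: principal_isotope_def)
  define c where "c = inv\<^bsub>?M\<^esub> g \<otimes>\<^bsub>?M\<^esub> inv\<^bsub>?M\<^esub> f"
  have c: "c \<in> carrier ?M"
    unfolding c_def by (intro M.m_closed M.inv_closed) (use fg in simp_all)
  have inv_c: "inv\<^bsub>?M\<^esub> c = f \<otimes>\<^bsub>?M\<^esub> g"
    unfolding c_def using M.inv_mult_group[OF M.inv_closed M.inv_closed, of g f] fg
      M.inv_inv[of f] M.inv_inv[of g] by simp
  have mult: "x \<otimes>\<^bsub>H\<^esub> y = x \<otimes>\<^bsub>?M\<^esub> c \<otimes>\<^bsub>?M\<^esub> y" if "x \<in> S" "y \<in> S" for x y
  proof -
    \<comment> \<open>These are the preimages of \<open>x\<close> and \<open>y\<close> under the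
      translations by \<open>g\<close> and \<open>f\<close>, so the defining equation of the isotope
      applies to them.\<close>
    let ?x = "x \<otimes>\<^bsub>?M\<^esub> inv\<^bsub>?M\<^esub> g" and ?y = "inv\<^bsub>?M\<^esub> f \<otimes>\<^bsub>?M\<^esub> y"
    have xy: "?x \<in> carrier ?M" "?y \<in> carrier ?M"
      by (rule M.m_closed M.inv_closed | simp add: that fg)+
    have "(?x \<otimes>\<^bsub>?M\<^esub> g) \<otimes>\<^bsub>H\<^esub> (f \<otimes>\<^bsub>?M\<^esub> ?y) = ?x \<otimes>\<^bsub>?M\<^esub> ?y"
      using H SG xy unfolding principal_isotope_def right_translation_def left_translation_def
      by (auto simp: subset_iff)
    moreover have "?x \<otimes>\<^bsub>?M\<^esub> g = x" "f \<otimes>\<^bsub>?M\<^esub> ?y = y"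
      using M.m_assoc[of x "inv\<^bsub>?M\<^esub> g" g] M.m_assoc[of f "inv\<^bsub>?M\<^esub> f" y]
        M.inv_closed[of g] M.inv_closed[of f] M.r_one[of x] M.l_one[of y]
        M.l_inv[of g] M.r_inv[of f] that fg
      by simp_all
    moreover have "?x \<otimes>\<^bsub>?M\<^esub> ?y = x \<otimes>\<^bsub>?M\<^esub> c \<otimes>\<^bsub>?M\<^esub> y"
      unfolding c_def using M.m_assoc M.inv_closed[of g] M.inv_closed[of f] M.m_closed that fg
      by simp
    ultimately show ?thesis by simp
  qed
  let ?u = "inv\<^bsub>?M\<^esub> c"
  have u: "?u \<in> S" using M.inv_closed[OF c] by simp
  \<comment> \<open>The unit of \<open>H\<close> is located as an idempotent: c^-1 is idempotent in
    \<open>H\<close>, and cancellation in \<open>H\<close> leaves only the unit. Hence the unit of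
    \<open>H\<close> lies in \<open>S\<close>.\<close>
  have "?u \<otimes>\<^bsub>H\<^esub> ?u = ?u" using mult[OF u u] M.l_inv[OF c] M.l_one[of ?u] u by simp
  also have "\<dots> = ?u \<otimes>\<^bsub>H\<^esub> \<one>\<^bsub>H\<^esub>" using H.r_one SH[OF u] by simp
  finally have one: "?u = \<one>\<^bsub>H\<^esub>"
    by (rule H.left_cancel) (use SH[OF u] H.one_closed in auto)
  have closed: "x \<otimes>\<^bsub>?M\<^esub> y \<in> S" if "x \<in> S" "y \<in> S" for x y using M.m_closed[of x y] that by simp
  have cS: "c \<in> S" using c by simp
  show ?thesis
  proof (rule groupI)
    fix x y assume "x \<in> carrier (H\<lparr>carrier := S\<rparr>)" "y \<in> carrier (H\<lparr>carrier := S\<rparr>)"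
    then show "x \<otimes>\<^bsub>H\<lparr>carrier := S\<rparr>\<^esub> y \<in> carrier (H\<lparr>carrier := S\<rparr>)"
      using mult[of x y] closed cS by simp
  next
    fix x y z
    assume "x \<in> carrier (H\<lparr>carrier := S\<rparr>)" "y \<in> carrier (H\<lparr>carrier := S\<rparr>)"
      "z \<in> carrier (H\<lparr>carrier := S\<rparr>)"
    then show "x \<otimes>\<^bsub>H\<lparr>carrier := S\<rparr>\<^esub> y \<otimes>\<^bsub>H\<lparr>carrier := S\<rparr>\<^esub> z
        = x \<otimes>\<^bsub>H\<lparr>carrier := S\<rparr>\<^esub> (y \<otimes>\<^bsub>H\<lparr>carrier := S\<rparr>\<^esub> z)"
      using M.m_assoc closed cS by (simp add: mult)
  next
    fix x assume x: "x \<in> carrier (H\<lparr>carrier := S\<rparr>)"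
    then show "\<one>\<^bsub>H\<lparr>carrier := S\<rparr>\<^esub> \<otimes>\<^bsub>H\<lparr>carrier := S\<rparr>\<^esub> x = x"
      using SH H.l_one by simp
    let ?y = "?u \<otimes>\<^bsub>?M\<^esub> inv\<^bsub>?M\<^esub> x \<otimes>\<^bsub>?M\<^esub> ?u"
    have y: "?y \<in> S" using u closed x M.inv_closed[of x] by simp
    have "?y \<otimes>\<^bsub>H\<^esub> x = ?u"
      using mult[of ?y x] y x c u M.inv_closed[of x]
      by (simp add: M_simps)
    then show "\<exists>y\<in>carrier (H\<lparr>carrier := S\<rparr>). y \<otimes>\<^bsub>H\<lparr>carrier := S\<rparr>\<^esub> x = \<one>\<^bsub>H\<lparr>carrier := S\<rparr>\<^esub>"
      using y one by auto
  qed (use u one in simp)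
qed

text \<open>The set underlying the S-subloop serves unchanged: it is again a group in the isotope,
  and groups are Moufang loops.\<close>

lemma smarandache_principal_isotope_moufang:
  assumes "smarandache_principal_isotope G H"
  shows "\<exists>S. nontrivial_moufang_subloop S H"
proof -
  obtain S f g where S: "subloop S G" "nontrivial S" "group (G\<lparr>carrier := S\<rparr>)"
    and fg: "f \<in> S" "g \<in> S" "principal_isotope G f g H"
    using assms unfolding smarandache_principal_isotope_def S_subloop_def by blast
  have "moufang_loop (H\<lparr>carrier := S\<rparr>)"
    by (rule group.moufang_loop[OF group_principal_isotope[OF S(1,3) fg]])
  then show ?thesis
    using S fg unfolding nontrivial_moufang_subloop_def subloop_def principal_isotope_def
    by (auto dest: moufang_loop.axioms(1))
qed

text \<open>Carries the subloop found in the principal isotope over to the isotopic loop itself,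
  which may live over another type.\<close>

lemma nontrivial_moufang_subloop_iso:
  assumes S: "nontrivial_moufang_subloop S K" and h: "bij_betw h (carrier K) (carrier H)"
    and hom: "\<And>x y. \<lbrakk>x \<in> carrier K; y \<in> carrier K\<rbrakk> \<Longrightarrow> h (x \<otimes>\<^bsub>K\<^esub> y) = h x \<otimes>\<^bsub>H\<^esub> h y"
    and one: "h \<one>\<^bsub>K\<^esub> = \<one>\<^bsub>H\<^esub>"
  shows "nontrivial_moufang_subloop (h ` S) H"
proof -
  have SK: "S \<subseteq> carrier K" and "nontrivial S" and M: "moufang_loop (K\<lparr>carrier := S\<rparr>)"
    using S by (auto simp: nontrivial_moufang_subloop_def subloop_def)
  have inj: "inj_on h S" using h SK unfolding bij_betw_def by (blast intro: inj_on_subset)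
  have "moufang_loop (H\<lparr>carrier := h ` S\<rparr>)"
    by (rule moufang_loop_iso[OF M, where h = h])
      (use inj SK hom one in \<open>auto simp: bij_betw_def subset_iff\<close>)
  moreover have "nontrivial (h ` S)"
    using \<open>nontrivial S\<close> inj unfolding nontrivial_def by (auto simp: inj_on_eq_iff)
  moreover have "h ` S \<subseteq> carrier H" using h SK by (auto simp: bij_betw_def)
  ultimately show ?thesis
    unfolding nontrivial_moufang_subloop_def subloop_def by (auto dest: moufang_loop.axioms(1))
qed

section \<open>Composing and rewriting autotopisms\<close>

lemma autotopism_fcomp:
  "\<lbrakk>autotopism G A B C; autotopism G A' B' C'\<rbrakk>
    \<Longrightarrow> autotopism G (A \<circ>> A') (B \<circ>> B') (C \<circ>> C')"
  unfolding autotopism_def isotopism_def fcomp_comp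
  by (auto intro: bij_betw_trans simp: bij_betw_apply)

text \<open>Inverse translations are given by \<open>inv_into\<close> and are unspecified off the
  carrier, so components can be compared on the carrier only. Closure of the loop keeps the
  products, to which \<open>C\<close> and \<open>C'\<close> are applied, in the carrier.\<close>

lemma autotopism_cong:
  assumes "autotopism G A B C" and "loop G"
    and "\<And>x. x \<in> carrier G \<Longrightarrow> A x = A' x" "\<And>x. x \<in> carrier G \<Longrightarrow> B x = B' x"
    and "\<And>x. x \<in> carrier G \<Longrightarrow> C x = C' x"
  shows "autotopism G A' B' C'"
  using assms bij_betw_cong[of "carrier G" A A' "carrier G"]
    bij_betw_cong[of "carrier G" B B' "carrier G"] bij_betw_cong[of "carrier G" C C' "carrier G"]
  unfolding autotopism_def isotopism_def by (auto simp: loop.m_closed)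

section \<open>Inverse property and Bol identities of Moufang loops\<close>

context moufang_loop
begin

text \<open>The right inverse can stand for the inverse because \<open>inv_mult\<close> shows it to
  be two-sided.\<close>

abbreviation moufang_inv where "moufang_inv \<equiv> right_inverse G"

lemmas inv_closed = right_inverse(1)

lemma flexible: "\<lbrakk>x \<in> carrier G; y \<in> carrier G\<rbrakk> \<Longrightarrow> x \<otimes> (y \<otimes> x) = (x \<otimes> y) \<otimes> x"
  using moufang[of x \<one> y] by (simp add: one_closed l_one r_one)

text \<open>Left inverse property: the Moufang identity with y = x^-1 reads z x = (x (x^-1 z)) x,
  and the last factor cancels.\<close>

lemma mult_inv_cancel:
  assumes "x \<in> carrier G" "z \<in> carrier G"
  shows "x \<otimes> (moufang_inv x \<otimes> z) = z"
proof (rule right_cancel[of _ x])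
  show "x \<otimes> (moufang_inv x \<otimes> z) \<otimes> x = z \<otimes> x"
    using moufang[of x "moufang_inv x" z] assms by (simp add: right_inverse l_one m_closed)
qed (use assms in \<open>simp_all add: m_closed inv_closed\<close>)

lemma inv_mult:
  assumes "x \<in> carrier G"
  shows "moufang_inv x \<otimes> x = \<one>"
  by (rule left_cancel[of x])
    (use assms mult_inv_cancel[of x x] in \<open>simp_all add: m_closed inv_closed one_closed r_one\<close>)

lemma inv_inv:
  assumes "x \<in> carrier G"
  shows "moufang_inv (moufang_inv x) = x"
  by (rule left_cancel[of "moufang_inv x"])
    (use assms in \<open>simp_all add: inv_closed inv_mult right_inverse(2)\<close>)

lemma inv_mult_cancel:
  assumes "x \<in> carrier G" "z \<in> carrier G"
  shows "moufang_inv x \<otimes> (x \<otimes> z) = z"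
  using mult_inv_cancel[of "moufang_inv x" z] assms by (simp add: inv_inv inv_closed)

text \<open>Right inverse property: with z = x^-1 the left side of the Moufang identity collapses to
  x y, and flexibility exposes a factor x on the left of the other side.\<close>

lemma mult_inv_cancel_right:
  assumes "x \<in> carrier G" "y \<in> carrier G"
  shows "(y \<otimes> moufang_inv x) \<otimes> x = y"
proof (rule left_cancel[of x])
  show "x \<otimes> ((y \<otimes> moufang_inv x) \<otimes> x) = x \<otimes> y"
    using moufang[of x y "moufang_inv x"] assms
    by (simp add: flexible inv_mult r_one m_closed inv_closed)
qed (use assms in \<open>simp_all add: m_closed inv_closed\<close>)

lemma inv_mult_cancel_right:
  assumes "x \<in> carrier G" "y \<in> carrier G"
  shows "(y \<otimes> x) \<otimes> moufang_inv x = y"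
  using mult_inv_cancel_right[of "moufang_inv x" y] assms by (simp add: inv_inv inv_closed)

lemmas cancel = mult_inv_cancel inv_mult_cancel mult_inv_cancel_right inv_mult_cancel_right

text \<open>The inverse property suffices: with p = x y, x = p y^-1 gives p^-1 x = y^-1, and
  multiplying by x^-1 on the right isolates p^-1.\<close>

lemma inv_of_mult:
  assumes xy: "x \<in> carrier G" "y \<in> carrier G"
  shows "moufang_inv (x \<otimes> y) = moufang_inv y \<otimes> moufang_inv x"
proof -
  let ?p = "x \<otimes> y"
  have "moufang_inv ?p \<otimes> x = moufang_inv ?p \<otimes> (?p \<otimes> moufang_inv y)"
    by (simp only: inv_mult_cancel_right[OF xy(2,1)])
  also have "\<dots> = moufang_inv y"
    by (rule inv_mult_cancel) (use xy in \<open>simp_all add: m_closed inv_closed\<close>)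
  finally show ?thesis
    using inv_mult_cancel_right[of x "moufang_inv ?p"] xy by (simp add: inv_closed m_closed)
qed

text \<open>With t = x v, the Moufang identity for x, w t, t^-1 gives (x (w t)) (t^-1 x) = (x w) x.
  Since t^-1 x = v^-1, multiplying by v on the right finishes.\<close>

lemma left_bol:
  assumes x: "x \<in> carrier G" and w: "w \<in> carrier G" and v: "v \<in> carrier G"
  shows "x \<otimes> (w \<otimes> (x \<otimes> v)) = ((x \<otimes> w) \<otimes> x) \<otimes> v"
proof -
  let ?t = "x \<otimes> v"
  have t: "?t \<in> carrier G" using x v by (simp add: m_closed)
  have "moufang_inv ?t \<otimes> x = moufang_inv v"
    using x v by (simp add: inv_of_mult cancel inv_closed)
  then have "(x \<otimes> (w \<otimes> ?t)) \<otimes> moufang_inv v = (x \<otimes> w) \<otimes> x"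
    using moufang[of x "w \<otimes> ?t" "moufang_inv ?t"] x w t by (simp add: cancel m_closed inv_closed)
  then show ?thesis
    using mult_inv_cancel_right[OF v, of "x \<otimes> (w \<otimes> ?t)"] x w t by (simp add: m_closed)
qed

text \<open>Mirror image of \<open>left_bol\<close>: with t = v x, the Moufang identity is applied
  to x, t^-1, t w, and x t^-1 = v^-1.\<close>

lemma right_bol:
  assumes x: "x \<in> carrier G" and w: "w \<in> carrier G" and v: "v \<in> carrier G"
  shows "((v \<otimes> x) \<otimes> w) \<otimes> x = v \<otimes> ((x \<otimes> w) \<otimes> x)"
proof -
  let ?t = "v \<otimes> x"
  have t: "?t \<in> carrier G" using x v by (simp add: m_closed)
  have "x \<otimes> moufang_inv ?t = moufang_inv v"
    using x v by (simp add: inv_of_mult cancel inv_closed)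
  then have "moufang_inv v \<otimes> ((?t \<otimes> w) \<otimes> x) = (x \<otimes> w) \<otimes> x"
    using moufang[of x "moufang_inv ?t" "?t \<otimes> w"] x w t by (simp add: cancel m_closed inv_closed)
  then show ?thesis
    using mult_inv_cancel[OF v, of "(?t \<otimes> w) \<otimes> x"] x w t by (simp add: m_closed)
qed

text \<open>Flexibility and the Moufang identity turn the inner term into (a x) (b a); the left Bol
  identity for b then splits it again. In the isotope with product (x b) (a y), the two commuting
  maps are left and right multiplication by the unit of \<open>G\<close>.\<close>

lemma translations_commute:
  assumes "a \<in> carrier G" "b \<in> carrier G" "x \<in> carrier G"
  shows "b \<otimes> (a \<otimes> ((x \<otimes> b) \<otimes> a)) = ((b \<otimes> (a \<otimes> x)) \<otimes> b) \<otimes> a"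
proof -
  have "a \<otimes> ((x \<otimes> b) \<otimes> a) = (a \<otimes> x) \<otimes> (b \<otimes> a)"
    using assms by (simp add: flexible moufang m_closed)
  then show ?thesis using left_bol[of b "a \<otimes> x" a] assms by (simp add: m_closed)
qed

section \<open>Translations of a Moufang loop and the autotopisms built from them\<close>

lemma bij_left_translation:
  assumes "a \<in> carrier G"
  shows "bij_betw (left_translation G a) (carrier G) (carrier G)"
  by (rule bij_betw_byWitness[where f' = "\<lambda>x. moufang_inv a \<otimes> x"])
    (use assms in \<open>auto simp: left_translation_def cancel m_closed inv_closed\<close>)

lemma bij_right_translation:
  assumes "a \<in> carrier G"
  shows "bij_betw (right_translation G a) (carrier G) (carrier G)"
  by (rule bij_betw_byWitness[where f' = "\<lambda>x. x \<otimes> moufang_inv a"])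
    (use assms in \<open>auto simp: right_translation_def cancel m_closed inv_closed\<close>)

lemma left_translation_inv:
  assumes "a \<in> carrier G" "x \<in> carrier G"
  shows "left_translation_inv G a x = moufang_inv a \<otimes> x"
  unfolding left_translation_inv_def
  by (rule inv_into_f_eq[OF bij_betw_imp_inj_on[OF bij_left_translation]])
    (use assms in \<open>auto simp: left_translation_def cancel m_closed inv_closed\<close>)

lemma right_translation_inv:
  assumes "a \<in> carrier G" "x \<in> carrier G"
  shows "right_translation_inv G a x = x \<otimes> moufang_inv a"
  unfolding right_translation_inv_def
  by (rule inv_into_f_eq[OF bij_betw_imp_inj_on[OF bij_right_translation]])
    (use assms in \<open>auto simp: right_translation_def cancel m_closed inv_closed\<close>)

lemma left_inverse_eq: "a \<in> carrier G \<Longrightarrow> left_inverse G a = moufang_inv a"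
  by (intro left_inverse_eqI) (simp_all add: inv_closed inv_mult)

lemma autotopism_left_bol:
  assumes a: "a \<in> carrier G"
  shows "autotopism G (left_translation G a \<circ>> right_translation G a)
    (left_translation G (moufang_inv a)) (left_translation G a)"
  unfolding autotopism_def isotopism_def
proof (intro conjI ballI)
  show "bij_betw (left_translation G a \<circ>> right_translation G a) (carrier G) (carrier G)"
    unfolding fcomp_comp by (rule bij_betw_trans[OF bij_left_translation bij_right_translation]) fact+
next
  fix x y assume "x \<in> carrier G" "y \<in> carrier G"
  then show "(left_translation G a \<circ>> right_translation G a) x
      \<otimes> left_translation G (moufang_inv a) y = left_translation G a (x \<otimes> y)"
    \<comment> \<open>The choice v = a^-1 y makes the inner product a v collapse to y.\<close>
    using a left_bol[of a x "moufang_inv a \<otimes> y"]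
    by (simp add: left_translation_def right_translation_def cancel m_closed inv_closed)
qed (use a in \<open>simp_all add: bij_left_translation inv_closed\<close>)

lemma autotopism_right_bol:
  assumes a: "a \<in> carrier G"
  shows "autotopism G (right_translation G (moufang_inv a))
    (left_translation G a \<circ>> right_translation G a) (right_translation G a)"
  unfolding autotopism_def isotopism_def
proof (intro conjI ballI)
  show "bij_betw (left_translation G a \<circ>> right_translation G a) (carrier G) (carrier G)"
    unfolding fcomp_comp by (rule bij_betw_trans[OF bij_left_translation bij_right_translation]) fact+
next
  fix x y assume "x \<in> carrier G" "y \<in> carrier G"
  then show "right_translation G (moufang_inv a) x
      \<otimes> (left_translation G a \<circ>> right_translation G a) y = right_translation G a (x \<otimes> y)"
    \<comment> \<open>Dually, v = x a^-1 makes v a collapse to x.\<close>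
    using a right_bol[of a y "x \<otimes> moufang_inv a"]
    by (simp add: left_translation_def right_translation_def cancel m_closed inv_closed)
qed (use a in \<open>simp_all add: bij_right_translation inv_closed\<close>)

lemma principal_isotope_autotopisms:
  fixes f g
  assumes f: "f \<in> carrier G" and g: "g \<in> carrier G"
  defines "R \<equiv> right_translation G" and "R' \<equiv> right_translation_inv G"
    and "L \<equiv> left_translation G" and "L' \<equiv> left_translation_inv G"
    and "f_rho \<equiv> right_inverse G f" and "g_lam \<equiv> left_inverse G g"
  shows
    "autotopism G
       (R g \<circ>> L' f \<circ>> L g_lam \<circ>> R' g)
       (L f \<circ>> R' g \<circ>> R f_rho \<circ>> L' f)
       (L' f \<circ>> L g_lam \<circ>> R' g \<circ>> R f_rho)" (is ?T1)
    "autotopism G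
       (R g \<circ>> L' f \<circ>> L g_lam \<circ>> R' g)
       (L f \<circ>> R' g \<circ>> R f_rho \<circ>> L' f)
       (R' g \<circ>> R f_rho \<circ>> L' f \<circ>> L g_lam)" (is ?T2)
    "autotopism G
       (R g \<circ>> L' f \<circ>> L g_lam \<circ>> R' g \<circ>> R f_rho \<circ>> R' g)
       (L f \<circ>> L' g_lam)
       (L' f \<circ>> L g_lam)" (is ?T3)
    "autotopism G
       (R g \<circ>> R' f_rho)
       (L f \<circ>> R' g \<circ>> R f_rho \<circ>> L' f \<circ>> L g_lam \<circ>> L' f)
       (R' g \<circ>> R f_rho)" (is ?T4)
    "autotopism G
       (R g \<circ>> L' f \<circ>> L g_lam \<circ>> R' g)
       (L g_lam \<circ>> R' g \<circ>> R f_rho \<circ>> L' g_lam)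
       (R' g \<circ>> R f_rho \<circ>> L' f \<circ>> L g_lam)" (is ?T5)
    "autotopism G
       (R f_rho \<circ>> L' f \<circ>> L g_lam \<circ>> R' f_rho)
       (L f \<circ>> R' g \<circ>> R f_rho \<circ>> L' f)
       (L' f \<circ>> L g_lam \<circ>> R' g \<circ>> R f_rho)" (is ?T6)
proof -
  \<comment> \<open>On the carrier \<open>L' f\<close>, \<open>L g_lam\<close>, \<open>R' g\<close>,
    \<open>R f_rho\<close> become the translations by \<open>a\<close>, \<open>b\<close>,
    \<open>b\<close>, \<open>a\<close>, while \<open>L' g_lam\<close> and \<open>R' f_rho\<close>
    become those by \<open>g\<close> and \<open>f\<close>. Each triple is thus a word in ordinary
    translations.\<close>
  define a b where "a = moufang_inv f" and "b = moufang_inv g"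
  have ab: "a \<in> carrier G" "b \<in> carrier G" using f g by (simp_all add: a_def b_def inv_closed)
  have inv_ab: "moufang_inv a = f" "moufang_inv b = g"
    using f g by (simp_all add: a_def b_def inv_inv)
  have inv_fg: "f_rho = a" "g_lam = b" "moufang_inv f = a" "moufang_inv g = b"
    using f g by (simp_all add: f_rho_def g_lam_def a_def b_def left_inverse_eq)
  note maps = R_def L_def R'_def L'_def inv_fg inv_ab
    right_translation_def left_translation_def right_translation_inv left_translation_inv
  note closed = f g ab m_closed
  note cancels = cancel[OF f, unfolded inv_fg] cancel[OF g, unfolded inv_fg]
  have commute: "b \<otimes> (a \<otimes> ((x \<otimes> b) \<otimes> a)) = ((b \<otimes> (a \<otimes> x)) \<otimes> b) \<otimes> a" if "x \<in> carrier G" for x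
    using translations_commute ab that by blast
  \<comment> \<open>Commutation at \<open>x \<otimes> g\<close>, where the factor \<open>b\<close>
    cancels \<open>g\<close>. It trades a leading \<open>R f_rho\<close> for a leading
    \<open>R g\<close> in the first components.\<close>
  have commute_f: "b \<otimes> (a \<otimes> (x \<otimes> a)) = ((b \<otimes> (a \<otimes> (x \<otimes> g))) \<otimes> b) \<otimes> a" if "x \<in> carrier G" for x
    using commute[of "x \<otimes> g"] that inv_mult_cancel_right[OF g that] by (simp add: inv_fg closed)
  \<comment> \<open>The counterpart for the second components: commutation at
    \<open>f \<otimes> x\<close>, where \<open>a\<close> cancels \<open>f\<close>, compared after
    multiplying by \<open>b\<close> on the left.\<close>
  have commute_g: "a \<otimes> (((f \<otimes> x) \<otimes> b) \<otimes> a) = g \<otimes> (((b \<otimes> x) \<otimes> b) \<otimes> a)" if "x \<in> carrier G" for x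
  proof (rule left_cancel[of b])
    show "b \<otimes> (a \<otimes> (((f \<otimes> x) \<otimes> b) \<otimes> a)) = b \<otimes> (g \<otimes> (((b \<otimes> x) \<otimes> b) \<otimes> a))"
      using commute[of "f \<otimes> x"] that inv_mult_cancel[OF f that]
        inv_mult_cancel[OF g, of "((b \<otimes> x) \<otimes> b) \<otimes> a"] by (simp add: inv_fg closed)
  qed (use that in \<open>simp_all add: closed\<close>)
  note \<beta> = autotopism_left_bol and \<rho> = autotopism_right_bol
  note \<beta>\<beta> = autotopism_fcomp[OF \<beta>[OF ab(1)] \<beta>[OF ab(2)]]
  note \<rho>\<rho> = autotopism_fcomp[OF \<rho>[OF ab(2)] \<rho>[OF ab(1)]]
  \<comment> \<open>Oriented to rewrite \<open>(a \<otimes> u) \<otimes> a\<close> to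
    \<open>a \<otimes> (u \<otimes> a)\<close>, the bracketing in \<open>commute_f\<close> and on
    the left of \<open>commute_g\<close>.\<close>
  note flexible_a = flexible[OF ab(1), symmetric]
  show ?T3
    by (rule autotopism_cong[OF \<beta>\<beta> loop_axioms])
      (simp_all add: maps closed flexible_a commute_f)
  show ?T4
    by (rule autotopism_cong[OF \<rho>\<rho> loop_axioms])
      (simp_all add: maps closed flexible_a commute_g cancels)
  show T5: ?T5
    by (rule autotopism_cong[OF autotopism_fcomp[OF \<rho>\<rho> \<beta>\<beta>] loop_axioms])
      (simp_all add: maps closed flexible_a cancels)
  show T6: ?T6
    by (rule autotopism_cong[OF autotopism_fcomp[OF \<beta>\<beta> \<rho>\<rho>] loop_axioms])
      (simp_all add: maps closed flexible_a cancels)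
  \<comment> \<open>The triples \<open>?T2\<close> and \<open>?T5\<close> differ only in the second
    component, \<open>?T1\<close> and \<open>?T6\<close> only in the first.\<close>
  show ?T2
    by (rule autotopism_cong[OF T5 loop_axioms]) (simp_all add: maps closed commute_g)
  show ?T1
    by (rule autotopism_cong[OF T6 loop_axioms]) (simp_all add: maps closed commute_f cancels)
qed

end

theorem theorem3p4:
  fixes G :: "'a monoid"
  assumes "smarandache_moufang_loop G"
  shows
    "((\<forall>H :: 'a monoid. (\<exists>f g. principal_isotope G f g H) \<longrightarrow> smarandache_principal_isotope G H)
        \<longrightarrow> universal_smarandache_moufang_loop TYPE('b) G)
     \<and>
     (universal_smarandache_moufang_loop TYPE('a) G
        \<longrightarrow> (\<exists>S. nontrivial_moufang_subloop S G \<and>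
              (\<forall>f\<in>S. \<forall>g\<in>S.
                 let M = G\<lparr>carrier := S\<rparr>;
                     R = right_translation M; R' = right_translation_inv M;
                     L = left_translation M; L' = left_translation_inv M;
                     f_rho = right_inverse M f; g_lam = left_inverse M g
                 in
                   autotopism M
                     (R g \<circ>> L' f \<circ>> L g_lam \<circ>> R' g)
                     (L f \<circ>> R' g \<circ>> R f_rho \<circ>> L' f)
                     (L' f \<circ>> L g_lam \<circ>> R' g \<circ>> R f_rho) \<and>
                   autotopism M
                     (R g \<circ>> L' f \<circ>> L g_lam \<circ>> R' g)
                     (L f \<circ>> R' g \<circ>> R f_rho \<circ>> L' f)
                     (R' g \<circ>> R f_rho \<circ>> L' f \<circ>> L g_lam) \<and>
                   autotopism M
                     (R g \<circ>> L' f \<circ>> L g_lam \<circ>> R' g \<circ>> R f_rho \<circ>> R' g)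
                     (L f \<circ>> L' g_lam)
                     (L' f \<circ>> L g_lam) \<and>
                   autotopism M
                     (R g \<circ>> R' f_rho)
                     (L f \<circ>> R' g \<circ>> R f_rho \<circ>> L' f \<circ>> L g_lam \<circ>> L' f)
                     (R' g \<circ>> R f_rho) \<and>
                   autotopism M
                     (R g \<circ>> L' f \<circ>> L g_lam \<circ>> R' g)
                     (L g_lam \<circ>> R' g \<circ>> R f_rho \<circ>> L' g_lam)
                     (R' g \<circ>> R f_rho \<circ>> L' f \<circ>> L g_lam) \<and>
                   autotopism M
                     (R f_rho \<circ>> L' f \<circ>> L g_lam \<circ>> R' f_rho)
                     (L f \<circ>> R' g \<circ>> R f_rho \<circ>> L' f)
                     (L' f \<circ>> L g_lam \<circ>> R' g \<circ>> R f_rho))))"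
proof (intro conjI impI, goal_cases)
  case 1
  have G: "loop G" using assms by (simp add: smarandache_moufang_loop_def)
  have "smarandache_moufang_loop H" if H: "loop H" "isotopic G H" for H :: "'b monoid"
  proof -
    obtain f g h and K :: "'a monoid" where K: "principal_isotope G f g K"
      and h: "bij_betw h (carrier K) (carrier H)"
        "\<And>x y. \<lbrakk>x \<in> carrier K; y \<in> carrier K\<rbrakk> \<Longrightarrow> h (x \<otimes>\<^bsub>K\<^esub> y) = h x \<otimes>\<^bsub>H\<^esub> h y"
        "h \<one>\<^bsub>K\<^esub> = \<one>\<^bsub>H\<^esub>"
      by (rule isotopic_imp_iso_principal_isotope[OF G H]) (rule that)
    \<comment> \<open>The hypothesis presents \<open>K\<close> as an isotope with respect to
      S-elements that may differ from \<open>f\<close> and \<open>g\<close>; this is harmless,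
      because only a subloop of \<open>K\<close> is wanted.\<close>
    obtain S where "nontrivial_moufang_subloop S K"
      using 1 K smarandache_principal_isotope_moufang by blast
    then have "nontrivial_moufang_subloop (h ` S) H"
      by (rule nontrivial_moufang_subloop_iso[OF _ h])
    then show ?thesis using H unfolding smarandache_moufang_loop_def by blast
  qed
  then show ?case
    using assms unfolding universal_smarandache_moufang_loop_def by blast
next
  case 2
  obtain S where S: "nontrivial_moufang_subloop S G"
    using assms unfolding smarandache_moufang_loop_def by blast
  then interpret M: moufang_loop "G\<lparr>carrier := S\<rparr>"
    by (simp add: nontrivial_moufang_subloop_def)
  show ?case
    unfolding Let_def
    by (intro exI[of _ S] conjI ballI S M.principal_isotope_autotopisms) simp_all
qed

end
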